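(* Let $K$ be a field of characteristic $0$, let $m\ge 2$, and let $G_3$ be the three-dimensional Lie algebra over $K$ with basis $\{p_1,p_2,p_3\}$ and multiplication $[p_1,p_2]=p_1$, $[p_1,p_3]=2p_2$, $[p_2,p_3]=p_3$. Let $K[[x_{ij}]]$ be the algebra of formal power series in the $3m$ variables $x_{ij}$, $i=1,2,3$, $j=1,\ldots,m$. Let $$X=x_1p_1+x_2p_2+x_3p_3,\quad Y=y_1p_1+y_2p_2+y_3p_3,\quad Z=z_1p_1+z_2p_2+z_3p_3$$ be elements of $K[[x_{ij}]]\otimes_K G_3$, where $x_i,y_i,z_i\in K[[x_{ij}]]$ have zero constant term, such that $$\exp(\mathrm{ad}\,Z)=\exp(\mathrm{ad}\,X)\exp(\mathrm{ad}\,Y).$$ Then: (i) For each $V=v_1p_1+v_2p_2+v_3p_3\in\{X,Y,Z\}$, with $g(V)=v_2^2-4v_1v_3$, one has $$P^3(V)=g(V)P(V),\qquad Q(\exp(\mathrm{ad}\,V))=I_3+A(V)P(V)+B(V)P^2(V),$$ where $I_3$ is the $3\times 3$ identity matrix and $$A(V)=\frac{\sinh(\sqrt{g(V)})}{\sqrt{g(V)}}=1+\frac{g(V)}{3!}+\frac{g^2(V)}{5!}+\cdots,\qquad B(V)=\frac{\cosh(\sqrt{g(V)})-1}{g(V)}=\frac12+\frac{g(V)}{4!}+\frac{g^2(V)}{6!}+\cdots .$$ (ii) If $Q(\exp(\mathrm{ad}\,Z))=(\sigma_{ij})$, $A=A(Z)$ and $B=B(Z)$, then $$z_1=\frac{M_1}{2A},\quad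 z_2=\frac{M_2}{2A},\quad z_3=\frac{M_3}{2A},$$ where $$M_1=-\sigma_{12}-\tfrac12\sigma_{23},\quad M_2=\sigma_{11}-\sigma_{33},\quad M_3=\tfrac12\sigma_{21}+\sigma_{32},$$ $$g(Z)=z_2^2-4z_1z_3=\left(\log\frac{1-M+\sqrt{1-2M}}{M}\right)^2,$$ $$M=\frac{2\sigma_{11}+2\sigma_{33}-4}{M_2^2-2M_1M_3}=\frac{2\sigma_{13}}{M_1^2}=\frac{2\sigma_{31}}{M_3^2}=\frac{\sigma_{21}-2\sigma_{32}}{M_2M_3}=\frac{\sigma_{23}-2\sigma_{12}}{M_1M_2}=\frac{1-\sigma_{22}}{M_1M_3}=\frac{B}{A^2}.$$
   Context: $K[[x_{ij}]]\otimes_KG_3$ is a Lie algebra over $K[[x_{ij}]]$, free as a module with basis $p_1,p_2,p_3$. For $V$ in it, $\mathrm{ad}\,V$ is the endomorphism $z\mapsto[z,V]$, and $\exp(\mathrm{ad}\,V)=\sum_{n\ge0}\mathrm{ad}^nV/n!$, which converges in the formal power series topology when the coordinates of $V$ have zero constant term. $P(V)$ and $Q(\exp(\mathrm{ad}\,V))$ are the matrices of $\mathrm{ad}\,V$ and $\exp(\mathrm{ad}\,V)$ with respect to the basis $\{p_1,p_2,p_3\}$ (the coordinates of the image of $p_j$ form the $j$-th column); thus $$P(V)=\begin{pmatrix}v_2&-v_1&0\\2v_3&0&-2v_1\\0&v_3&-v_2\end{pmatrix}.$$ Interpretation of the formulas: $M=B/A^2\in K[[x_{ij}]]$ has constant term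 $1/2$; each of the other displayed quotients expressing $M$ is understood when its denominator is nonzero. The expression $\left(\log\frac{1-M+\sqrt{1-2M}}{M}\right)^2$ denotes $\left(\log(1+h+\sqrt{h^2+2h})\right)^2$ with $h=(1-2M)/M$ (a series with zero constant term), i.e. $\Lambda(h)$, where $\Lambda\in\mathbb{Q}[[h]]$ is the unique power series without constant term such that $\Lambda\left(\sum_{n\ge1}\frac{w^n}{(2n)!}\right)=w$ in $\mathbb{Q}[[w]]$ (that is, $\Lambda(\cosh\sqrt w-1)=w$). *)

theory Defs
  imports
    "HOL-Analysis.Analysis"
    "HOL-Computational_Algebra.Fraction_Field"
    "HOL-Computational_Algebra.Formal_Power_Series"
    "HOL-Computational_Algebra.Polynomial_Factorial"
begin

section \<open>Formal power series in finitely many variables\<close>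

text \<open>The variables are indexed by the finite type \<open>'v\<close>; a monomial is its vector of exponents
  in \<open>nat ^ 'v\<close>, so that multiplication of monomials is addition of vectors.\<close>

typedef ('a, 'v) mfps = "UNIV :: (nat ^ 'v \<Rightarrow> 'a) set"
  morphisms mcoeff Abs_mfps
  by simp

lemma mcoeff_Abs [simp]: "mcoeff (Abs_mfps f) = f"
  by (simp add: Abs_mfps_inverse)

lemma mfps_eqI: "(\<And>n. mcoeff f n = mcoeff g n) \<Longrightarrow> f = g"
  by (metis mcoeff_inject ext)

lemma mfps_eq_iff: "f = g \<longleftrightarrow> (\<forall>n. mcoeff f n = mcoeff g n)"
  by (auto intro: mfps_eqI)

definition mconst :: "'a::zero \<Rightarrow> ('a, 'v::finite) mfps"
  where "mconst c = Abs_mfps (\<lambda>n. if n = 0 then c else 0)"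

lemma finite_antidiagonal: "finite {(a, b). a + b = (n :: nat ^ 'v::finite)}"
proof -
  have fin: "finite {a :: nat ^ 'v. a \<le> n}"
  proof -
    have "finite (vec_lambda ` (PiE (UNIV :: 'v set) (\<lambda>i. {..n $ i})))"
      by (intro finite_imageI finite_PiE) auto
    moreover have "{a :: nat ^ 'v. a \<le> n} \<subseteq> vec_lambda ` (PiE UNIV (\<lambda>i. {..n $ i}))"
    proof
      fix a assume "a \<in> {a :: nat ^ 'v. a \<le> n}"
      then have "vec_nth a \<in> PiE UNIV (\<lambda>i. {..n $ i})"
        by (auto simp: less_eq_vec_def)
      then show "a \<in> vec_lambda ` (PiE UNIV (\<lambda>i. {..n $ i}))"
        by (metis image_eqI vec_nth_inverse)
    qed
    ultimately show ?thesis by (rule rev_finite_subset)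
  qed
  show ?thesis
    by (rule finite_subset[OF _ finite_cartesian_product[OF fin fin]])
       (auto simp: less_eq_vec_def)
qed

subsection \<open>Ring structure\<close>

instantiation mfps :: (zero, finite) zero
begin
definition "0 = Abs_mfps (\<lambda>_. 0)"
instance ..
end

instantiation mfps :: ("{zero, one}", finite) one
begin
definition "1 = Abs_mfps (\<lambda>n. if n = 0 then 1 else 0)"
instance ..
end

instantiation mfps :: (plus, finite) plus
begin
definition "f + g = Abs_mfps (\<lambda>n. mcoeff f n + mcoeff g n)"
instance ..
end

instantiation mfps :: (minus, finite) minus
begin
definition "f - g = Abs_mfps (\<lambda>n. mcoeff f n - mcoeff g n)"
instance ..
end

instantiation mfps :: (uminus, finite) uminus
begin
definition "- f = Abs_mfps (\<lambda>n. - mcoeff f n)"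
instance ..
end

instantiation mfps :: ("{comm_monoid_add, times}", finite) times
begin
definition "f * g = Abs_mfps (\<lambda>n. \<Sum>(a, b)\<in>{(a, b). a + b = n}. mcoeff f a * mcoeff g b)"
instance ..
end

lemma mcoeff_0 [simp]: "mcoeff 0 n = 0"
  by (simp add: zero_mfps_def)

lemma mcoeff_1: "mcoeff 1 n = (if n = 0 then 1 else 0)"
  by (simp add: one_mfps_def)

lemma mcoeff_add [simp]: "mcoeff (f + g) n = mcoeff f n + mcoeff g n"
  by (simp add: plus_mfps_def)

lemma mcoeff_diff [simp]: "mcoeff (f - g) n = mcoeff f n - mcoeff g n"
  by (simp add: minus_mfps_def)

lemma mcoeff_uminus [simp]: "mcoeff (- f) n = - mcoeff f n"
  by (simp add: uminus_mfps_def)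

lemma mcoeff_mult:
  "mcoeff (f * g) n = (\<Sum>(a, b)\<in>{(a, b). a + b = n}. mcoeff f a * mcoeff g b)"
  by (simp add: times_mfps_def)

lemma mcoeff_mconst: "mcoeff (mconst c) n = (if n = 0 then c else 0)"
  by (simp add: mconst_def)

instance mfps :: (comm_monoid_add, finite) comm_monoid_add
  by standard (auto intro!: mfps_eqI simp: add_ac)

instance mfps :: (ab_group_add, finite) ab_group_add
  by standard (auto intro!: mfps_eqI)

lemma mcoeff_mconst_mult [simp]:
  fixes f :: "('a::semiring_0, 'v::finite) mfps"
  shows "mcoeff (mconst c * f) n = c * mcoeff f n"
proof -
  have "mcoeff (mconst c * f) n = (\<Sum>(a, b)\<in>{(0 :: nat ^ 'v, n)}. mcoeff (mconst c) a * mcoeff f b)"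
    unfolding mcoeff_mult
    by (intro sum.mono_neutral_right finite_antidiagonal) (auto simp: mcoeff_mconst split: if_splits)
  then show ?thesis by (simp add: mcoeff_mconst)
qed

instance mfps :: (comm_ring_1, finite) comm_ring_1
proof
  fix f g h :: "('a, 'b) mfps"
  show "f * g * h = f * (g * h)"
  proof (rule mfps_eqI)
    fix n
    let ?D = "\<lambda>n :: nat ^ 'b. {(a, b). a + b = n}"
    have "mcoeff (f * g * h) n =
        (\<Sum>(x, c)\<in>?D n. \<Sum>(a, b)\<in>?D x. mcoeff f a * mcoeff g b * mcoeff h c)"
      by (simp add: mcoeff_mult sum_distrib_right case_prod_unfold)
    also have "\<dots> = (\<Sum>(y, z)\<in>Sigma (?D n) (\<lambda>y. ?D (fst y)).
        mcoeff f (fst z) * mcoeff g (snd z) * mcoeff h (snd y))"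
      by (subst sum.Sigma[symmetric]) (simp_all add: finite_antidiagonal[unfolded case_prod_unfold] case_prod_unfold)
    also have "\<dots> = (\<Sum>(y, z)\<in>Sigma (?D n) (\<lambda>y. ?D (snd y)).
        mcoeff f (fst y) * (mcoeff g (fst z) * mcoeff h (snd z)))"
      by (rule sum.reindex_bij_witness[where
            i = "\<lambda>((a, x), (b, c)). ((a + b, c), (a, b))" and
            j = "\<lambda>((x, c), (a, b)). ((a, b + c), (b, c))"])
         (auto simp: add.assoc mult.assoc)
    also have "\<dots> = (\<Sum>(a, x)\<in>?D n. \<Sum>(b, c)\<in>?D x. mcoeff f a * (mcoeff g b * mcoeff h c))"
      by (subst sum.Sigma[symmetric]) (simp_all add: finite_antidiagonal[unfolded case_prod_unfold] case_prod_unfold)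
    also have "\<dots> = mcoeff (f * (g * h)) n"
      by (simp add: mcoeff_mult sum_distrib_left case_prod_unfold)
    finally show "mcoeff (f * g * h) n = mcoeff (f * (g * h)) n" .
  qed
  show "f * g = g * f"
    by (rule mfps_eqI, unfold mcoeff_mult,
        rule sum.reindex_bij_witness[where i = prod.swap and j = prod.swap])
       (auto simp: add.commute mult.commute)
  have "(1 :: ('a, 'b) mfps) = mconst 1"
    by (rule mfps_eqI) (simp add: mcoeff_1 mcoeff_mconst)
  then show "1 * f = f"
    by (metis mfps_eqI mcoeff_mconst_mult mult_1)
  show "(f + g) * h = f * h + g * h"
    by (rule mfps_eqI)
       (simp add: mcoeff_mult distrib_right case_prod_unfold sum.distrib)
  show "(0 :: ('a, 'b) mfps) \<noteq> 1"
    by (metis mcoeff_0 mcoeff_1 zero_neq_one)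
qed

text \<open>Two nonempty sets of monomials contain a pair whose product arises only once.\<close>

lemma unique_product:
  fixes A B :: "(nat ^ 'v::finite) set"
  assumes "finite S" "A \<noteq> {}" "B \<noteq> {}"
  shows "\<exists>a\<in>A. \<exists>b\<in>B. \<forall>a'\<in>A. \<forall>b'\<in>B. a' + b' = a + b \<longrightarrow>
           (\<forall>v\<in>S. a' $ v = a $ v \<and> b' $ v = b $ v)"
  using assms
proof (induction S arbitrary: A B rule: finite_induct)
  case empty
  then show ?case by auto
next
  case (insert v S)
  obtain a0 where a0: "a0 \<in> A" "\<And>a. a \<in> A \<Longrightarrow> a0 $ v \<le> a $ v"
    using insert.prems(1) ex_has_least_nat[of "\<lambda>a. a \<in> A" _ "\<lambda>a. a $ v"] by blast
  obtain b0 where b0: "b0 \<in> B" "\<And>b. b \<in> B \<Longrightarrow> b0 $ v \<le> b $ v"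
    using insert.prems(2) ex_has_least_nat[of "\<lambda>b. b \<in> B" _ "\<lambda>b. b $ v"] by blast
  let ?A = "{a \<in> A. a $ v = a0 $ v}" and ?B = "{b \<in> B. b $ v = b0 $ v}"
  have "?A \<noteq> {}" "?B \<noteq> {}" using a0 b0 by auto
  from insert.IH[OF this] obtain a b where ab: "a \<in> ?A" "b \<in> ?B"
    "\<forall>a'\<in>?A. \<forall>b'\<in>?B. a' + b' = a + b \<longrightarrow> (\<forall>v\<in>S. a' $ v = a $ v \<and> b' $ v = b $ v)"
    by blast
  have "\<forall>u\<in>insert v S. a' $ u = a $ u \<and> b' $ u = b $ u"
    if "a' \<in> A" "b' \<in> B" "a' + b' = a + b" for a' b'
  proof -
    have "a' $ v + b' $ v = a $ v + b $ v"
      using that(3) by (metis vector_add_component)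
    then have "a' $ v = a0 $ v" "b' $ v = b0 $ v"
      using a0(2)[OF that(1)] b0(2)[OF that(2)] ab(1,2) by auto
    moreover from this have "a' \<in> ?A" "b' \<in> ?B" using that(1,2) by auto
    then have "\<forall>u\<in>S. a' $ u = a $ u \<and> b' $ u = b $ u" using ab(3) that(3) by blast
    ultimately show ?thesis using ab(1,2) by simp
  qed
  moreover have "a \<in> A" "b \<in> B" using ab(1,2) by auto
  ultimately show ?case by (metis (no_types, lifting))
qed

instance mfps :: (idom, finite) idom
proof
  fix f g :: "('a, 'b) mfps"
  assume "f \<noteq> 0" "g \<noteq> 0"
  let ?A = "{n. mcoeff f n \<noteq> 0}" and ?B = "{n. mcoeff g n \<noteq> 0}"
  have "?A \<noteq> {}" "?B \<noteq> {}"
    using \<open>f \<noteq> 0\<close> \<open>g \<noteq> 0\<close> by (auto simp: mfps_eq_iff)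
  from unique_product[OF finite this, of UNIV] obtain a b where ab: "a \<in> ?A" "b \<in> ?B"
    "\<forall>a'\<in>?A. \<forall>b'\<in>?B. a' + b' = a + b \<longrightarrow> (\<forall>v. a' $ v = a $ v \<and> b' $ v = b $ v)"
    by auto
  have uniq: "x = a \<and> y = b" if "x + y = a + b" "mcoeff f x \<noteq> 0" "mcoeff g y \<noteq> 0" for x y
    using ab(3)[rule_format, of x y] that by (auto simp: vec_eq_iff)
  have "mcoeff (f * g) (a + b) = (\<Sum>(x, y)\<in>{(a, b)}. mcoeff f x * mcoeff g y)"
    unfolding mcoeff_mult
  proof (intro sum.mono_neutral_right finite_antidiagonal)
    show "\<forall>i\<in>{(x, y). x + y = a + b} - {(a, b)}.
            (case i of (x, y) \<Rightarrow> mcoeff f x * mcoeff g y) = 0"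
      using uniq by auto
  qed auto
  also have "\<dots> \<noteq> 0" using ab by simp
  finally show "f * g \<noteq> 0" by (metis mcoeff_0)
qed

text \<open>Exact division: \<open>f div g\<close> is the quotient of \<open>f\<close> by \<open>g\<close> if this lies in the power series
  ring, and \<open>0\<close> otherwise.\<close>

instantiation mfps :: (idom, finite) idom_divide
begin
definition "f div g = (if g \<noteq> 0 \<and> g dvd f then THE q. f = q * g else (0 :: ('a, 'b) mfps))"
instance
proof
  fix f g :: "('a, 'b) mfps"
  assume "g \<noteq> 0"
  then have "(THE q. f * g = q * g) = f" by (intro the_equality) auto
  with \<open>g \<noteq> 0\<close> show "f * g div g = f" by (simp add: divide_mfps_def)
qed (simp add: divide_mfps_def)
end

subsection \<open>Formal power series topology\<close>

definition mdeg :: "nat ^ 'v::finite \<Rightarrow> nat"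
  where "mdeg n = (\<Sum>v\<in>UNIV. n $ v)"

text \<open>The sets \<open>f + I\<^sup>N\<close>, for the ideal \<open>I\<close> of the series without constant term, form a
  neighbourhood base at \<open>f\<close>.\<close>

instantiation mfps :: (type, finite) t2_space
begin
definition open_mfps :: "('a, 'b) mfps set \<Rightarrow> bool" where
  "open_mfps U \<longleftrightarrow>
     (\<forall>f\<in>U. \<exists>N. \<forall>g. (\<forall>n. mdeg n < N \<longrightarrow> mcoeff g n = mcoeff f n) \<longrightarrow> g \<in> U)"
instance
proof
  show "open (UNIV :: ('a, 'b) mfps set)" by (simp add: open_mfps_def)
next
  fix S T :: "('a, 'b) mfps set"
  assume S: "open S" and T: "open T"
  show "open (S \<inter> T)"
    unfolding open_mfps_def
  proof
    fix f assume "f \<in> S \<inter> T"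
    with S T obtain M N where
      "\<forall>g. (\<forall>n. mdeg n < M \<longrightarrow> mcoeff g n = mcoeff f n) \<longrightarrow> g \<in> S"
      "\<forall>g. (\<forall>n. mdeg n < N \<longrightarrow> mcoeff g n = mcoeff f n) \<longrightarrow> g \<in> T"
      unfolding open_mfps_def by blast
    then show "\<exists>N. \<forall>g. (\<forall>n. mdeg n < N \<longrightarrow> mcoeff g n = mcoeff f n) \<longrightarrow> g \<in> S \<inter> T"
      by (intro exI[of _ "max M N"]) auto
  qed
next
  fix K :: "('a, 'b) mfps set set"
  assume "\<forall>S\<in>K. open S"
  then show "open (\<Union>K)" unfolding open_mfps_def by (meson Union_iff)
next
  fix f g :: "('a, 'b) mfps"
  assume "f \<noteq> g"
  then obtain n where n: "mcoeff f n \<noteq> mcoeff g n" by (auto simp: mfps_eq_iff)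
  have op: "open {h. mcoeff h n = c}" for c :: 'a
    unfolding open_mfps_def by (auto intro!: exI[of _ "Suc (mdeg n)"])
  show "\<exists>U V. open U \<and> open V \<and> f \<in> U \<and> g \<in> V \<and> U \<inter> V = {}"
    using op[of "mcoeff f n"] op[of "mcoeff g n"] n
    by (intro exI[of _ "{h. mcoeff h n = mcoeff f n}"] exI[of _ "{h. mcoeff h n = mcoeff g n}"]) auto
qed
end

text \<open>A series of power series converges if the order of its terms tends to infinity.\<close>

lemma mfps_sums:
  fixes f :: "nat \<Rightarrow> ('a::comm_monoid_add, 'v::finite) mfps"
  assumes "\<And>k n. mdeg n < k \<Longrightarrow> mcoeff (f k) n = 0"
  shows "f sums Abs_mfps (\<lambda>n. \<Sum>k\<le>mdeg n. mcoeff (f k) n)"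
  unfolding sums_def
proof (rule topological_tendstoI)
  have coeff_sum: "mcoeff (sum f A) n = (\<Sum>k\<in>A. mcoeff (f k) n)" if "finite A" for A n
    using that by (induction A rule: finite_induct) auto
  let ?s = "Abs_mfps (\<lambda>n. \<Sum>k\<le>mdeg n. mcoeff (f k) n)"
  fix U assume "open U" and "?s \<in> U"
  then obtain N where N: "\<forall>g. (\<forall>n. mdeg n < N \<longrightarrow> mcoeff g n = mcoeff ?s n) \<longrightarrow> g \<in> U"
    unfolding open_mfps_def by (rule bspec[elim_format]) blast
  have "sum f {..<M} \<in> U" if "M \<ge> N" for M
  proof (rule N[rule_format])
    fix n :: "nat ^ 'v" assume "mdeg n < N"
    with that show "mcoeff (sum f {..<M}) n = mcoeff ?s n"
      unfolding mcoeff_Abs by (subst coeff_sum) (auto intro!: sum.mono_neutral_right assms)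
  qed
  then show "\<forall>\<^sub>F M in sequentially. sum f {..<M} \<in> U"
    by (auto simp: eventually_sequentially)
qed

subsection \<open>Substitution into a univariate series with rational coefficients\<close>

definition fps_subst :: "rat fps \<Rightarrow> ('a::field_char_0, 'v::finite) mfps \<Rightarrow> ('a, 'v) mfps"
  where "fps_subst F g = (\<Sum>n. mconst (of_rat (fps_nth F n)) * g ^ n)"


section \<open>The Lie algebra with extended scalars\<close>

text \<open>An element \<open>v\<^sub>1 p\<^sub>1 + v\<^sub>2 p\<^sub>2 + v\<^sub>3 p\<^sub>3\<close> is represented by its coordinate vector
  \<open>V\<close>, the basis element \<open>p\<^sub>i\<close> by \<open>axis i 1\<close>. The bracket is the bilinear extension of the
  multiplication table of the basis.\<close>

definition G3_table :: "3 \<Rightarrow> 3 \<Rightarrow> 'r::comm_ring_1 ^ 3" where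
  "G3_table i j =
    (if (i, j) = (1, 2) then axis 1 1
     else if (i, j) = (1, 3) then 2 *s axis 2 1
     else if (i, j) = (2, 3) then axis 3 1
     else if (i, j) = (2, 1) then - axis 1 1
     else if (i, j) = (3, 1) then - (2 *s axis 2 1)
     else if (i, j) = (3, 2) then - axis 3 1
     else 0)"

definition G3_bracket :: "'r::comm_ring_1 ^ 3 \<Rightarrow> 'r ^ 3 \<Rightarrow> 'r ^ 3" where
  "G3_bracket U V = (\<Sum>i\<in>UNIV. \<Sum>j\<in>UNIV. (U $ i * V $ j) *s G3_table i j)"

definition ad :: "'r::comm_ring_1 ^ 3 \<Rightarrow> 'r ^ 3 \<Rightarrow> 'r ^ 3"
  where "ad V = (\<lambda>z. G3_bracket z V)"

lemma G3_bracket_explicit: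
  "G3_bracket U V = vector [U$1 * V$2 - U$2 * V$1, 2 * (U$1 * V$3 - U$3 * V$1), U$2 * V$3 - U$3 * V$2]"
  by (simp add: G3_bracket_def G3_table_def vec_eq_iff forall_3 sum_3 vector_scalar_mult_def
      axis_def vector_3 algebra_simps)

lemma G3_bracket_basis:
  "G3_bracket (axis 1 1) (axis 2 1) = axis 1 1"
  "G3_bracket (axis 1 1) (axis 3 1) = 2 *s axis 2 1"
  "G3_bracket (axis 2 1) (axis 3 1) = axis 3 1"
  by (simp_all add: G3_bracket_explicit vec_eq_iff forall_3 vector_scalar_mult_def axis_def vector_3)

lemma G3_bracket_Lie:
  "G3_bracket U U = 0"
  "G3_bracket U (G3_bracket V W) + G3_bracket V (G3_bracket W U) + G3_bracket W (G3_bracket U V) = 0"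
  by (simp_all add: G3_bracket_explicit vec_eq_iff forall_3 vector_3 algebra_simps)

text \<open>\<open>matrix\<close> is the matrix whose \<open>j\<close>-th column is the image of \<open>p\<^sub>j\<close>.\<close>

lemma matrix_ad:
  "matrix (ad V) = vector [vector [V$2, - V$1, 0],
                           vector [2 * V$3, 0, - 2 * V$1],
                           vector [0, V$3, - V$2]]"
  by (simp add: matrix_def ad_def G3_bracket_explicit vec_eq_iff forall_3 axis_def vector_3)

text \<open>The exponential of an endomorphism; the series converges pointwise in the formal power
  series topology.\<close>

definition exp_end ::
  "(('a::field_char_0, 'v::finite) mfps ^ 3 \<Rightarrow> ('a, 'v) mfps ^ 3) \<Rightarrow>
    ('a, 'v) mfps ^ 3 \<Rightarrow> ('a, 'v) mfps ^ 3"
  where "exp_end \<phi> z = (\<Sum>n. mconst (1 / fact n) *s (\<phi> ^^ n) z)"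

definition matrix_smult :: "'r::times \<Rightarrow> 'r ^ 'n ^ 'm \<Rightarrow> 'r ^ 'n ^ 'm" (infixr \<open>*m\<close> 75)
  where "c *m S = (\<chi> i j. c * S $ i $ j)"

definition G3_g :: "'r::comm_ring_1 ^ 3 \<Rightarrow> 'r"
  where "G3_g V = (V $ 2)^2 - 4 * V $ 1 * V $ 3"

text \<open>\<open>sinh \<surd>t / \<surd>t\<close> and \<open>(cosh \<surd>t - 1) / t\<close> as power series in \<open>t\<close>.\<close>

definition sinhc_fps :: "rat fps"
  where "sinhc_fps = Abs_fps (\<lambda>n. 1 / fact (2 * n + 1))"

definition coshc_fps :: "rat fps"
  where "coshc_fps = Abs_fps (\<lambda>n. 1 / fact (2 * n + 2))"

definition G3_A :: "('a::field_char_0, 'v::finite) mfps ^ 3 \<Rightarrow> ('a, 'v) mfps"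
  where "G3_A V = fps_subst sinhc_fps (G3_g V)"

definition G3_B :: "('a::field_char_0, 'v::finite) mfps ^ 3 \<Rightarrow> ('a, 'v) mfps"
  where "G3_B V = fps_subst coshc_fps (G3_g V)"

text \<open>The series \<open>(log (1 + h + \<surd>(h\<^sup>2 + 2h)))\<^sup>2\<close> in \<open>h\<close>: it is determined by
  \<open>Lambda (cosh \<surd>w - 1) = w\<close> and the absence of a constant term.\<close>

definition coshm1_fps :: "rat fps"
  where "coshm1_fps = Abs_fps (\<lambda>n. if n = 0 then 0 else 1 / fact (2 * n))"

definition Lambda :: "rat fps"
  where "Lambda = (THE L. fps_nth L 0 = 0 \<and> L oo coshm1_fps = fps_X)"

lemma Lambda_ex1: "\<exists>!L. fps_nth L 0 = 0 \<and> L oo coshm1_fps = fps_X"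
proof (rule ex1I[of _ "fps_inv coshm1_fps"])
  have c: "fps_nth coshm1_fps 0 = 0" "fps_nth coshm1_fps 1 \<noteq> 0"
    by (simp_all add: coshm1_fps_def)
  show "fps_nth (fps_inv coshm1_fps) 0 = 0 \<and> fps_inv coshm1_fps oo coshm1_fps = fps_X"
    using fps_inv[OF c] by (simp add: fps_inv_def)
  fix L assume "fps_nth L 0 = 0 \<and> L oo coshm1_fps = fps_X"
  then have "(L oo coshm1_fps) oo fps_inv coshm1_fps = fps_inv coshm1_fps"
    by (simp add: fps_inv_def)
  then show "L = fps_inv coshm1_fps"
    using fps_inv_right[OF c] c by (subst (asm) fps_compose_assoc[symmetric]) (simp_all add: fps_inv_def)
qed

end

theory Submission
  imports Defs
begin

text \<open>
  Everything follows from the single relation \<open>ad\<^sup>3 V = g(V) ad V\<close>, valid in this Lie algebra over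
  any commutative ring. It collapses the exponential series: the odd powers of \<open>ad V\<close> are multiples
  of \<open>ad V\<close>, the even ones multiples of \<open>ad\<^sup>2 V\<close>, and collecting coefficients gives
  \<open>exp (ad V) = 1 + A ad V + B ad\<^sup>2 V\<close> (\<open>exp_end_ad\<close>).

  In the \<open>3 \<times> 3\<close> matrix of this endomorphism, the combinations \<open>M\<^sub>i\<close> are chosen so that the part
  with \<open>B\<close> cancels, leaving \<open>M\<^sub>i = 2 A z\<^sub>i\<close>, while the numerators of the displayed quotients are the
  complementary combinations free of the part with \<open>A\<close>. Each numerator is therefore \<open>B/A\<^sup>2\<close>
  times its denominator, because both are the same quadratic form in \<open>z\<close>, up to the factors \<open>B\<close>
  and \<open>A\<^sup>2\<close>.

  It remains to recover \<open>g\<close> from \<open>M = B/A\<^sup>2\<close>. With \<open>C = cosh \<surd>g\<close>, the identity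
  \<open>sinh\<^sup>2 = (cosh - 1) (cosh + 1)\<close> reads \<open>A\<^sup>2 = B (C + 1)\<close> (\<open>G3_A_square\<close>). Hence \<open>M\<close> is the inverse
  of the unit \<open>C + 1\<close>, the argument \<open>(1 - 2 M)/M\<close> equals \<open>C - 1\<close>, and \<open>Lambda\<close> inverts
  \<open>w \<mapsto> cosh \<surd>w - 1\<close> by definition. These identities are proved for univariate series
  and carried over to multivariate ones, because substituting a series without constant term is a ring
  homomorphism compatible with composition (\<open>fps_subst_mult\<close>, \<open>fps_subst_compose\<close>).
\<close>

section \<open>Order of a multivariate power series\<close>

text \<open>Membership in the ideal \<open>I\<^sup>k\<close>, for \<open>I\<close> the ideal of the series without constant term; these
  are the basic neighbourhoods of 0.\<close>

definition order_ge :: "nat \<Rightarrow> ('a::zero, 'v::finite) mfps \<Rightarrow> bool"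
  where "order_ge k f \<longleftrightarrow> (\<forall>n. mdeg n < k \<longrightarrow> mcoeff f n = 0)"

lemma mdeg_add: "mdeg (a + b) = mdeg a + mdeg b"
  by (simp add: mdeg_def sum.distrib)

lemma mdeg_eq_0_iff: "mdeg n = 0 \<longleftrightarrow> n = 0"
  by (auto simp: mdeg_def vec_eq_iff)

lemma order_ge_0 [simp]: "order_ge 0 f"
  by (simp add: order_ge_def)

lemma order_ge_1_iff: "order_ge 1 f \<longleftrightarrow> mcoeff f 0 = 0"
  by (auto simp: order_ge_def mdeg_eq_0_iff)

lemma order_ge_diff:
  fixes f g :: "('a::comm_ring_1, 'v::finite) mfps"
  shows "order_ge k f \<Longrightarrow> order_ge k g \<Longrightarrow> order_ge k (f - g)"
  by (simp add: order_ge_def)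

lemma order_ge_mult:
  fixes f g :: "('a::comm_ring_1, 'v::finite) mfps"
  assumes "order_ge i f" "order_ge j g"
  shows "order_ge (i + j) (f * g)"
  unfolding order_ge_def mcoeff_mult
proof (intro allI impI sum.neutral ballI)
  fix n and p :: "(nat ^ 'v) \<times> (nat ^ 'v)"
  assume "mdeg n < i + j" "p \<in> {(a, b). a + b = n}"
  then have "mdeg (fst p) < i \<or> mdeg (snd p) < j"
    by (auto simp: mdeg_add)
  then show "(case p of (a, b) \<Rightarrow> mcoeff f a * mcoeff g b) = 0"
    using assms by (auto simp: order_ge_def case_prod_unfold)
qed

lemma order_ge_mult_left:
  fixes f g :: "('a::comm_ring_1, 'v::finite) mfps"
  shows "order_ge k g \<Longrightarrow> order_ge k (f * g)"
  using order_ge_mult[of 0 f k g] by simp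

lemma order_ge_power:
  fixes g :: "('a::comm_ring_1, 'v::finite) mfps"
  assumes "mcoeff g 0 = 0"
  shows "order_ge k (g ^ k)"
proof (induction k)
  case (Suc k)
  then show ?case using order_ge_mult[of 1 g k "g ^ k"] assms by (simp add: order_ge_1_iff[simplified])
qed simp

lemma mcoeff_sum: "mcoeff (sum f A) n = (\<Sum>k\<in>A. mcoeff (f k :: ('a::comm_monoid_add, 'v::finite) mfps) n)"
  by (induction A rule: infinite_finite_induct) auto

text \<open>Working with any sufficiently large cutoff \<open>N\<close>, instead of the exact one \<open>mdeg n\<close>, lets all
  series in an identity be truncated at the same point.\<close>

lemma sums_mfps:
  fixes f :: "nat \<Rightarrow> ('a::comm_ring_1, 'v::finite) mfps"
  assumes "\<And>k. order_ge k (f k)"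
  obtains s where "f sums s" "\<And>n N. mdeg n < N \<Longrightarrow> mcoeff s n = (\<Sum>k<N. mcoeff (f k) n)"
proof -
  let ?s = "Abs_mfps (\<lambda>n. \<Sum>k\<le>mdeg n. mcoeff (f k) n)"
  have "f sums ?s"
    using assms by (intro mfps_sums) (auto simp: order_ge_def)
  moreover have "mcoeff ?s n = (\<Sum>k<N. mcoeff (f k) n)" if "mdeg n < N" for n N
    using that assms unfolding mcoeff_Abs
    by (intro sum.mono_neutral_left) (auto simp: order_ge_def)
  ultimately show ?thesis by (rule that)
qed

section \<open>Substitution into univariate power series\<close>

lemma mconst_1 [simp]: "mconst 1 = (1 :: ('a::comm_ring_1, 'v::finite) mfps)"
  by (rule mfps_eqI) (simp add: mcoeff_mconst mcoeff_1)

text \<open>Substitution is used only through finite sums of coefficients. The extra factor \<open>w\<close> lets one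
  of two multiplied series be expanded while the other is kept, which gives multiplicativity, and
  evaluates products such as \<open>A(V) z\<close> in the exponential.\<close>

lemma mcoeff_fps_subst_mult:
  fixes g w :: "('a::field_char_0, 'v::finite) mfps"
  assumes g: "mcoeff g 0 = 0" and n: "mdeg n < N"
  shows "mcoeff (fps_subst F g * w) n = (\<Sum>k<N. of_rat (fps_nth F k) * mcoeff (g ^ k * w) n)"
proof -
  define t where "t = (\<lambda>k. mconst (of_rat (fps_nth F k)) * g ^ k)"
  have ord: "order_ge k (t k)" for k
    unfolding t_def by (intro order_ge_mult_left order_ge_power g)
  obtain s where s: "t sums s"
    "\<And>n N. mdeg n < N \<Longrightarrow> mcoeff s n = (\<Sum>k<N. mcoeff (t k) n)"
    using sums_mfps[of t] ord by blast
  have subst: "fps_subst F g = s"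
    using sums_unique[OF s(1)] by (simp add: fps_subst_def t_def)
  \<comment> \<open>Cut \<open>s\<close> at degree \<open>N\<close>: the tail has order \<open>N\<close> and cannot reach the monomial \<open>n\<close>.\<close>
  have split: "s * w = (\<Sum>k<N. t k * w) + w * (s - sum t {..<N})"
    by (simp add: algebra_simps sum_distrib_left)
  have "order_ge N (s - sum t {..<N})"
    unfolding order_ge_def
  proof (intro allI impI)
    fix m :: "nat ^ 'v" assume "mdeg m < N"
    then show "mcoeff (s - sum t {..<N}) m = 0"
      using s(2)[of m N] by (simp add: mcoeff_sum)
  qed
  then have "mcoeff (w * (s - sum t {..<N})) n = 0"
    using order_ge_mult_left n unfolding order_ge_def by blast
  then show ?thesis
    unfolding subst split by (simp add: mcoeff_sum t_def mult.assoc)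
qed

lemmas mcoeff_fps_subst = mcoeff_fps_subst_mult[where w = 1, simplified]

lemma mcoeff_fps_subst_0:
  fixes g :: "('a::field_char_0, 'v::finite) mfps"
  assumes "mcoeff g 0 = 0"
  shows "mcoeff (fps_subst F g) 0 = of_rat (fps_nth F 0)"
  using mcoeff_fps_subst[OF assms, of 0 1 F] by (simp add: mdeg_eq_0_iff mcoeff_1)

lemma fps_subst_add:
  fixes g :: "('a::field_char_0, 'v::finite) mfps"
  assumes "mcoeff g 0 = 0"
  shows "fps_subst (F + G) g = fps_subst F g + fps_subst G g"
  by (rule mfps_eqI)
    (simp add: mcoeff_fps_subst[OF assms lessI] of_rat_add distrib_right sum.distrib del: sum.lessThan_Suc)

lemma fps_subst_const:
  fixes g :: "('a::field_char_0, 'v::finite) mfps"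
  assumes "mcoeff g 0 = 0"
  shows "fps_subst (fps_const c) g = mconst (of_rat c)"
proof (rule mfps_eqI)
  fix n :: "nat ^ 'v"
  have "mcoeff (fps_subst (fps_const c) g) n
      = (\<Sum>k<Suc (mdeg n). of_rat (fps_nth (fps_const c) k) * mcoeff (g ^ k) n)"
    by (rule mcoeff_fps_subst[OF assms lessI])
  also have "\<dots> = (\<Sum>k\<in>{0}. of_rat (fps_nth (fps_const c) k) * mcoeff (g ^ k) n)"
    by (rule sum.mono_neutral_right) auto
  finally show "mcoeff (fps_subst (fps_const c) g) n = mcoeff (mconst (of_rat c)) n"
    by (simp add: mcoeff_1 mcoeff_mconst)
qed

lemma fps_subst_1:
  fixes g :: "('a::field_char_0, 'v::finite) mfps"
  assumes "mcoeff g 0 = 0"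
  shows "fps_subst 1 g = 1"
  using fps_subst_const[OF assms, of 1] by simp

lemma fps_subst_2:
  fixes g :: "('a::field_char_0, 'v::finite) mfps"
  assumes "mcoeff g 0 = 0"
  shows "fps_subst 2 g = 2"
  using fps_subst_add[OF assms, of 1 1] by (simp add: fps_subst_1[OF assms])

lemma fps_subst_X:
  fixes g :: "('a::field_char_0, 'v::finite) mfps"
  assumes "mcoeff g 0 = 0"
  shows "fps_subst fps_X g = g"
proof (rule mfps_eqI)
  fix n :: "nat ^ 'v"
  have "mcoeff (fps_subst fps_X g) n
      = (\<Sum>k<mdeg n + 2. of_rat (fps_nth fps_X k) * mcoeff (g ^ k) n)"
    by (rule mcoeff_fps_subst[OF assms]) simp
  also have "\<dots> = (\<Sum>k\<in>{1}. of_rat (fps_nth fps_X k) * mcoeff (g ^ k) n)"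
    by (rule sum.mono_neutral_right) auto
  finally show "mcoeff (fps_subst fps_X g) n = mcoeff g n" by simp
qed

text \<open>This is the Cauchy product. Below degree \<open>N\<close> the square of index pairs \<open>i, j < N\<close> may be
  replaced by the triangle \<open>i + j < N\<close>, because \<open>g\<^sup>i\<^sup>+\<^sup>j\<close> has order at least \<open>i + j\<close>.\<close>

lemma fps_subst_mult:
  fixes g :: "('a::field_char_0, 'v::finite) mfps"
  assumes g: "mcoeff g 0 = 0"
  shows "fps_subst (F * G) g = fps_subst F g * fps_subst G g"
proof (rule mfps_eqI)
  fix n :: "nat ^ 'v"
  define N where "N = Suc (mdeg n)"
  have N: "mdeg n < N" by (simp add: N_def)
  define t where "t = (\<lambda>i j. of_rat (fps_nth F i) * of_rat (fps_nth G j) * mcoeff (g ^ (i + j)) n :: 'a)"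
  have t0: "t i j = 0" if "N \<le> i + j" for i j
    using order_ge_power[OF g, of "i + j"] that N unfolding t_def order_ge_def by simp
  have inner: "mcoeff (g ^ i * fps_subst G g) n = (\<Sum>j<N. of_rat (fps_nth G j) * mcoeff (g ^ (i + j)) n)" for i
    unfolding mult.commute[of "g ^ i"] mcoeff_fps_subst_mult[OF g N] by (simp only: power_add mult.commute)
  have "mcoeff (fps_subst F g * fps_subst G g) n = (\<Sum>i<N. \<Sum>j<N. t i j)"
    unfolding mcoeff_fps_subst_mult[OF g N] inner t_def by (simp only: sum_distrib_left mult.assoc)
  also have "\<dots> = (\<Sum>(i, j)\<in>{..<N} \<times> {..<N}. t i j)"
    by (rule sum.cartesian_product)
  also have "\<dots> = (\<Sum>(i, j)\<in>{(i, j). i + j < N}. t i j)"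
    by (rule sum.mono_neutral_right) (auto intro: t0)
  also have "\<dots> = (\<Sum>k<N. \<Sum>i\<le>k. t i (k - i))"
    by (rule sum.triangle_reindex)
  also have "\<dots> = (\<Sum>k<N. of_rat (fps_nth (F * G) k) * mcoeff (g ^ k) n)"
    by (simp add: t_def fps_mult_nth of_rat_sum of_rat_mult sum_distrib_right atMost_atLeast0)
  also have "\<dots> = mcoeff (fps_subst (F * G) g) n"
    by (rule mcoeff_fps_subst[OF g N, symmetric])
  finally show "mcoeff (fps_subst (F * G) g) n = mcoeff (fps_subst F g * fps_subst G g) n" ..
qed

lemma fps_subst_power:
  fixes g :: "('a::field_char_0, 'v::finite) mfps"
  assumes "mcoeff g 0 = 0"
  shows "fps_subst (F ^ k) g = fps_subst F g ^ k"
  by (induction k) (simp_all add: fps_subst_1 fps_subst_mult assms)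

lemma fps_subst_compose:
  fixes g :: "('a::field_char_0, 'v::finite) mfps"
  assumes g: "mcoeff g 0 = 0" and G: "fps_nth G 0 = 0"
  shows "fps_subst (F oo G) g = fps_subst F (fps_subst G g)"
proof (rule mfps_eqI)
  fix n :: "nat ^ 'v"
  define N where "N = Suc (mdeg n)"
  have N: "mdeg n < N" by (simp add: N_def)
  have Gg: "mcoeff (fps_subst G g) 0 = 0"
    by (simp add: mcoeff_fps_subst_0[OF g] G)
  \<comment> \<open>\<open>G\<^sup>i\<close> has no terms below degree \<open>i\<close>, so one range for \<open>i\<close> serves all \<open>k < N\<close>, and the two
      summations can be exchanged.\<close>
  have compose: "fps_nth (F oo G) k = (\<Sum>i<N. fps_nth F i * fps_nth (G ^ i) k)" if "k < N" for k
    unfolding fps_compose_nth using that startsby_zero_power_prefix[OF G]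
    by (intro sum.mono_neutral_left) auto
  have "mcoeff (fps_subst (F oo G) g) n
      = (\<Sum>k<N. \<Sum>i<N. of_rat (fps_nth F i) * (of_rat (fps_nth (G ^ i) k) * mcoeff (g ^ k) n))"
    by (simp add: mcoeff_fps_subst[OF g N] compose of_rat_sum of_rat_mult sum_distrib_right mult.assoc)
  also have "\<dots> = (\<Sum>i<N. of_rat (fps_nth F i) * mcoeff (fps_subst (G ^ i) g) n)"
    by (subst sum.swap) (simp add: mcoeff_fps_subst[OF g N] sum_distrib_left)
  also have "\<dots> = mcoeff (fps_subst F (fps_subst G g)) n"
    by (simp add: mcoeff_fps_subst[OF Gg N] fps_subst_power[OF g])
  finally show "mcoeff (fps_subst (F oo G) g) n = mcoeff (fps_subst F (fps_subst G g)) n" .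
qed

section \<open>Hyperbolic functions of a square root\<close>

lemma coshm1_fps_eq: "coshm1_fps = fps_X * coshc_fps"
proof (rule fps_ext)
  fix n
  show "fps_nth coshm1_fps n = fps_nth (fps_X * coshc_fps) n"
    by (cases n) (simp_all add: coshm1_fps_def coshc_fps_def)
qed

text \<open>The identity \<open>sinh\<^sup>2 = (cosh - 1) (cosh + 1)\<close> in the variable \<open>t\<close> standing for the square of
  the argument, divided by \<open>t\<close>. With \<open>c = cosh \<surd>t\<close> and \<open>s = sinh \<surd>t / \<surd>t\<close> the equations
  \<open>2 c' = s\<close> and \<open>2 t s' + s = c\<close> show that the derivative of \<open>c\<^sup>2 - t s\<^sup>2\<close> vanishes, so this is the
  constant 1.\<close>

lemma sinhc_fps_square: "sinhc_fps ^ 2 = coshc_fps * (coshm1_fps + 2)"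
proof -
  define c where "c = 1 + coshm1_fps"
  let ?s = sinhc_fps
  have c': "2 * fps_deriv c = ?s"
  proof (rule fps_ext)
    fix n
    have "fact (2 * n + 2) = (2 * of_nat n + 2) * (fact (2 * n + 1) :: rat)"
      by (simp add: algebra_simps)
    then show "fps_nth (2 * fps_deriv c) n = fps_nth ?s n"
      by (simp add: c_def coshm1_fps_def sinhc_fps_def fps_numeral_simps numeral_fps_const divide_simps)
  qed
  have s': "2 * fps_X * fps_deriv ?s + ?s = c"
  proof (rule fps_ext)
    fix n
    have "fact (2 * n + 1) = (2 * of_nat n + 1) * (fact (2 * n) :: rat)"
      by (simp add: algebra_simps)
    then show "fps_nth (2 * fps_X * fps_deriv ?s + ?s) n = fps_nth c n"
      by (cases n) (simp_all add: c_def coshm1_fps_def sinhc_fps_def numeral_fps_const mult.assoc divide_simps)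
  qed
  have "fps_deriv (c ^ 2 - fps_X * ?s ^ 2)
      = c * (2 * fps_deriv c) - ?s * (2 * fps_X * fps_deriv ?s + ?s)"
    by (simp add: power2_eq_square algebra_simps)
  also have "\<dots> = 0"
    unfolding c' s' by simp
  finally have "c ^ 2 - fps_X * ?s ^ 2 = fps_const (fps_nth (c ^ 2 - fps_X * ?s ^ 2) 0)"
    unfolding fps_deriv_eq_0_iff .
  also have "\<dots> = 1"
    by (simp add: c_def coshm1_fps_def power2_eq_square)
  finally have "fps_X * ?s ^ 2 = (c - 1) * (c + 1)"
    by (simp add: algebra_simps power2_eq_square)
  also have "\<dots> = fps_X * (coshc_fps * (coshm1_fps + 2))"
    by (simp add: c_def coshm1_fps_eq algebra_simps)
  finally show ?thesis by simp
qed

lemma Lambda_compose_coshm1: "Lambda oo coshm1_fps = fps_X"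
  using theI'[OF Lambda_ex1] by (simp add: Lambda_def)

section \<open>The exponential of \<open>ad V\<close>\<close>

lemma ad_scale: "ad V (c *s z) = c *s ad V z"
  by (simp add: ad_def G3_bracket_explicit vec_eq_iff forall_3 vector_3 algebra_simps)

lemma ad_cube: "ad V (ad V (ad V z)) = G3_g V *s ad V z"
  by (simp add: ad_def G3_bracket_explicit G3_g_def vec_eq_iff forall_3 vector_3 power2_eq_square
      algebra_simps)

lemma ad_funpow_odd: "(ad V ^^ (2 * k + 1)) z = G3_g V ^ k *s ad V z"
  by (induction k) (simp_all add: ad_scale ad_cube vector_smult_assoc mult.commute)

lemma ad_funpow_even: "(ad V ^^ (2 * k + 2)) z = G3_g V ^ k *s ad V (ad V z)"
  using ad_funpow_odd[of k V z] by (simp add: ad_scale)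

text \<open>This makes the exponential series converge: each bracket with \<open>V\<close> raises the order.\<close>

lemma order_ge_ad_funpow:
  fixes V z :: "('a::comm_ring_1, 'v::finite) mfps ^ 3"
  assumes V: "\<And>i. mcoeff (V $ i) 0 = 0"
  shows "order_ge k ((ad V ^^ k) z $ i)"
proof (induction k arbitrary: i)
  case (Suc k)
  let ?w = "(ad V ^^ k) z"
  have "order_ge (Suc k) (?w $ j * V $ l)" for j l
    using order_ge_mult[OF Suc, of 1 "V $ l" j] V order_ge_1_iff[of "V $ l"] by simp
  then have "\<forall>i. order_ge (Suc k) (G3_bracket ?w V $ i)"
    unfolding forall_3 G3_bracket_explicit vector_3
    by (intro conjI order_ge_diff order_ge_mult_left[of _ _ 2])
  then show ?case by (simp add: ad_def)
qed simp

lemma mcoeff_G3_g_0: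
  fixes V :: "('a::comm_ring_1, 'v::finite) mfps ^ 3"
  assumes V: "\<And>i. mcoeff (V $ i) 0 = 0"
  shows "mcoeff (G3_g V) 0 = 0"
  unfolding G3_g_def power2_eq_square order_ge_1_iff[symmetric]
  by (intro order_ge_diff order_ge_mult_left) (simp_all only: order_ge_1_iff V)

lemma sum_split_odd_even:
  "(\<Sum>k<2 * N + 1. f k) = f 0 + (\<Sum>j<N. f (2 * j + 1)) + (\<Sum>j<N. f (2 * j + 2))"
  for f :: "nat \<Rightarrow> 'a::comm_monoid_add"
  by (induction N) (simp_all add: add_ac)

text \<open>The product topology makes limits exist, and be unique, coordinate by coordinate.\<close>

lemma suminf_vec_eqI:
  fixes f :: "nat \<Rightarrow> 'a::{t2_space, comm_monoid_add} ^ 'n::finite"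
  assumes s: "\<And>i. (\<lambda>k. f k $ i) sums (s $ i)"
  shows "suminf f = s"
  unfolding suminf_def
proof (rule the_equality)
  show "f sums s"
    unfolding sums_def using s by (intro vec_tendstoI) (simp add: sums_def)
  fix s' assume s': "f sums s'"
  have "(\<lambda>k. f k $ i) sums (s' $ i)" for i
    using tendsto_vec_nth[OF s'[unfolded sums_def], of i] by (simp add: sums_def)
  then show "s' = s"
    using s by (metis sums_unique2 vec_eq_iff)
qed

text \<open>In the exponential series, \<open>ad\<^sup>2\<^sup>j\<^sup>+\<^sup>1 V = g\<^sup>j ad V\<close> occurs with the coefficient \<open>1/(2j+1)!\<close> of the
  series of \<open>A\<close>, and \<open>ad\<^sup>2\<^sup>j\<^sup>+\<^sup>2 V = g\<^sup>j ad\<^sup>2 V\<close> with the coefficient \<open>1/(2j+2)!\<close> of the series of \<open>B\<close>.\<close>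

lemma exp_end_ad:
  fixes V z :: "('a::field_char_0, 'v::finite) mfps ^ 3"
  assumes V: "\<And>i. mcoeff (V $ i) 0 = 0"
  shows "exp_end (ad V) z = z + G3_A V *s ad V z + G3_B V *s ad V (ad V z)"
proof -
  let ?g = "G3_g V"
  note g = mcoeff_G3_g_0[OF V]
  have of_rat_inverse_fact: "of_rat (1 / fact m) = (1 / fact m :: 'a)" for m
    by (metis of_nat_fact of_rat_1 of_rat_divide of_rat_of_nat_eq)
  define t where "t = (\<lambda>k. mconst (1 / fact k) *s (ad V ^^ k) z)"
  have ord: "order_ge k (t k $ i)" for k i
    unfolding t_def vector_smult_component by (intro order_ge_mult_left order_ge_ad_funpow V)
  have "\<exists>s. (\<lambda>k. t k $ i) sums s \<and>
      (\<forall>n N. mdeg n < N \<longrightarrow> mcoeff s n = (\<Sum>k<N. mcoeff (t k $ i) n))" for i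
    using sums_mfps[of "\<lambda>k. t k $ i"] ord by metis
  then obtain s where s: "\<And>i. (\<lambda>k. t k $ i) sums s i"
    "\<And>i n N. mdeg n < N \<Longrightarrow> mcoeff (s i) n = (\<Sum>k<N. mcoeff (t k $ i) n)"
    by metis
  have "exp_end (ad V) z = (\<chi> i. s i)"
    unfolding exp_end_def t_def[symmetric] using s(1) by (intro suminf_vec_eqI) simp
  moreover have "s i = (z + G3_A V *s ad V z + G3_B V *s ad V (ad V z)) $ i" for i
  proof (rule mfps_eqI)
    fix n :: "nat ^ 'v"
    define N where "N = Suc (mdeg n)"
    have N: "mdeg n < N" "mdeg n < 2 * N + 1" by (simp_all add: N_def)
    have "mcoeff (s i) n = mcoeff (t 0 $ i) n
        + (\<Sum>j<N. mcoeff (t (2 * j + 1) $ i) n) + (\<Sum>j<N. mcoeff (t (2 * j + 2) $ i) n)"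
      unfolding s(2)[OF N(2)] by (rule sum_split_odd_even)
    also have "mcoeff (t 0 $ i) n = mcoeff (z $ i) n"
      by (simp add: t_def)
    also have "(\<Sum>j<N. mcoeff (t (2 * j + 1) $ i) n) = mcoeff (G3_A V * ad V z $ i) n"
      unfolding t_def ad_funpow_odd G3_A_def mcoeff_fps_subst_mult[OF g N(1)]
      by (intro sum.cong refl) (simp add: sinhc_fps_def of_rat_inverse_fact mult.assoc del: fact_Suc)
    also have "(\<Sum>j<N. mcoeff (t (2 * j + 2) $ i) n) = mcoeff (G3_B V * ad V (ad V z) $ i) n"
      unfolding t_def ad_funpow_even G3_B_def mcoeff_fps_subst_mult[OF g N(1)]
      by (intro sum.cong refl) (simp add: coshc_fps_def of_rat_inverse_fact mult.assoc del: fact_Suc)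
    finally show "mcoeff (s i) n = mcoeff ((z + G3_A V *s ad V z + G3_B V *s ad V (ad V z)) $ i) n"
      by simp
  qed
  ultimately show ?thesis by (simp add: vec_eq_iff)
qed

lemma matrix_ad_cube: "matrix (ad V) ** matrix (ad V) ** matrix (ad V) = G3_g V *m matrix (ad V)"
  by (simp add: matrix_ad matrix_matrix_mult_def sum_3 vec_eq_iff forall_3 vector_3 matrix_smult_def
      G3_g_def power2_eq_square algebra_simps)

lemma matrix_ad_square:
  "matrix (ad V) ** matrix (ad V) =
    vector [vector [(V$2)^2 - 2 * (V$1 * V$3), - (V$1 * V$2), 2 * (V$1)^2],
            vector [2 * (V$2 * V$3), - 4 * (V$1 * V$3), 2 * (V$1 * V$2)],
            vector [2 * (V$3)^2, - (V$2 * V$3), (V$2)^2 - 2 * (V$1 * V$3)]]"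
  by (simp add: matrix_ad matrix_matrix_mult_def sum_3 vec_eq_iff forall_3 vector_3
      power2_eq_square algebra_simps)

lemma matrix_exp_end_ad:
  fixes V :: "('a::field_char_0, 'v::finite) mfps ^ 3"
  assumes V: "\<And>i. mcoeff (V $ i) 0 = 0"
  shows "matrix (exp_end (ad V)) =
    mat 1 + G3_A V *m matrix (ad V) + G3_B V *m (matrix (ad V) ** matrix (ad V))"
  unfolding matrix_ad_square unfolding matrix_ad unfolding matrix_def exp_end_ad[OF V]
  by (simp add: ad_def G3_bracket_explicit mat_def matrix_smult_def axis_def
      vec_eq_iff forall_3 vector_3 power2_eq_square algebra_simps)

section \<open>Recovering \<open>Z\<close> from the matrix of its exponential\<close>

lemma to_fract_eq_divideI:
  assumes "d \<noteq> 0" "m * d = n"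
  shows "to_fract m = to_fract n / to_fract d"
  using assms by (auto simp: divide_simps)

lemma G3_A_square:
  fixes V :: "('a::field_char_0, 'v::finite) mfps ^ 3"
  assumes V: "\<And>i. mcoeff (V $ i) 0 = 0"
  shows "G3_A V ^ 2 = G3_B V * (fps_subst coshm1_fps (G3_g V) + 2)"
  unfolding G3_A_def G3_B_def
  using mcoeff_G3_g_0[OF V]
  by (simp add: sinhc_fps_square fps_subst_mult fps_subst_add fps_subst_2 flip: fps_subst_power)

lemma G3_A_neq_0:
  fixes V :: "('a::field_char_0, 'v::finite) mfps ^ 3"
  assumes V: "\<And>i. mcoeff (V $ i) 0 = 0"
  shows "G3_A V \<noteq> 0"
proof
  assume "G3_A V = 0"
  moreover have "mcoeff (G3_A V) 0 = 1"
    by (simp add: G3_A_def mcoeff_fps_subst_0[OF mcoeff_G3_g_0[OF V]] sinhc_fps_def)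
  ultimately show False by simp
qed

text \<open>The constant term is 2, so the univariate series has an inverse, and substitution carries this
  inverse to the multivariate ring.\<close>

lemma coshm1_plus_2_unit:
  fixes g :: "('a::field_char_0, 'v::finite) mfps"
  assumes g: "mcoeff g 0 = 0"
  obtains m where "m * (fps_subst coshm1_fps g + 2) = 1"
proof -
  let ?F = "coshm1_fps + 2"
  have "inverse ?F * ?F = 1"
    by (rule inverse_mult_eq_1) (simp add: coshm1_fps_def numeral_fps_const)
  then have "fps_subst (inverse ?F) g * fps_subst ?F g = 1"
    by (simp add: fps_subst_1[OF g] flip: fps_subst_mult[OF g])
  then show ?thesis
    by (intro that[of "fps_subst (inverse ?F) g"]) (simp add: fps_subst_add[OF g] fps_subst_2[OF g])
qed

text \<open>Since \<open>A\<^sup>2 = B (C + 1)\<close> with \<open>C = cosh \<surd>g\<close>, the quotient \<open>M = B/A\<^sup>2\<close> is \<open>1/(C + 1)\<close>; in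
  particular the exact divisions below do not fall back to their default value 0, and
  \<open>(1 - 2 M)/M = C - 1\<close>, from which \<open>Lambda\<close> recovers \<open>g\<close>.\<close>

lemma G3_g_eq_Lambda:
  fixes V :: "('a::field_char_0, 'v::finite) mfps ^ 3"
  assumes V: "\<And>i. mcoeff (V $ i) 0 = 0"
  defines "M \<equiv> G3_B V div G3_A V ^ 2"
  shows "M * G3_A V ^ 2 = G3_B V"
    and "G3_g V = fps_subst Lambda ((1 - 2 * M) div M)"
proof -
  note g = mcoeff_G3_g_0[OF V]
  let ?h = "fps_subst coshm1_fps (G3_g V)"
  obtain m where m: "m * (?h + 2) = 1"
    using coshm1_plus_2_unit[OF g] .
  have B: "G3_B V = m * G3_A V ^ 2"
    unfolding G3_A_square[OF V] using m by (metis mult.left_commute mult.right_neutral)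
  then have M: "M = m"
    unfolding M_def using G3_A_neq_0[OF V] by simp
  show "M * G3_A V ^ 2 = G3_B V"
    by (simp add: M B)
  have "m \<noteq> 0"
    using m by auto
  moreover have "1 - 2 * m = ?h * m"
    unfolding m[symmetric] by (simp add: algebra_simps)
  ultimately have "(1 - 2 * M) div M = ?h"
    by (simp add: M)
  moreover have "fps_nth coshm1_fps 0 = 0"
    by (simp add: coshm1_fps_def)
  ultimately show "G3_g V = fps_subst Lambda ((1 - 2 * M) div M)"
    by (simp add: Lambda_compose_coshm1 fps_subst_X[OF g] flip: fps_subst_compose[OF g])
qed

theorem corollary4:
  fixes X Y Z :: "('k::field_char_0, 3 \<times> 'm::finite) mfps ^ 3"
  assumes "CARD('m) \<ge> 2"
    and "\<forall>V\<in>{X, Y, Z}. \<forall>i. mcoeff (V $ i) 0 = 0"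
    and "exp_end (ad Z) = exp_end (ad X) \<circ> exp_end (ad Y)"
  shows
    "(\<forall>V\<in>{X, Y, Z}. let P = matrix (ad V); Q = matrix (exp_end (ad V)) in
        P ** P ** P = G3_g V *m P \<and>
        Q = mat 1 + G3_A V *m P + G3_B V *m (P ** P)) \<and>
     (let \<sigma> = (\<lambda>i j. matrix (exp_end (ad Z)) $ i $ j);
          A = G3_A Z;
          B = G3_B Z;
          M1 = - \<sigma> 1 2 - mconst (1/2) * \<sigma> 2 3;
          M2 = \<sigma> 1 1 - \<sigma> 3 3;
          M3 = mconst (1/2) * \<sigma> 2 1 + \<sigma> 3 2;
          M = B div A^2;
          h = (1 - 2 * M) div M
      in to_fract (Z $ 1) = to_fract M1 / to_fract (2 * A) \<and>
         to_fract (Z $ 2) = to_fract M2 / to_fract (2 * A) \<and>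
         to_fract (Z $ 3) = to_fract M3 / to_fract (2 * A) \<and>
         G3_g Z = fps_subst Lambda h \<and>
         to_fract M = to_fract B / to_fract (A^2) \<and>
         (M2^2 - 2 * M1 * M3 \<noteq> 0 \<longrightarrow>
            to_fract M = to_fract (2 * \<sigma> 1 1 + 2 * \<sigma> 3 3 - 4) / to_fract (M2^2 - 2 * M1 * M3)) \<and>
         (M1^2 \<noteq> 0 \<longrightarrow> to_fract M = to_fract (2 * \<sigma> 1 3) / to_fract (M1^2)) \<and>
         (M3^2 \<noteq> 0 \<longrightarrow> to_fract M = to_fract (2 * \<sigma> 3 1) / to_fract (M3^2)) \<and>
         (M2 * M3 \<noteq> 0 \<longrightarrow> to_fract M = to_fract (\<sigma> 2 1 - 2 * \<sigma> 3 2) / to_fract (M2 * M3)) \<and>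
         (M1 * M2 \<noteq> 0 \<longrightarrow> to_fract M = to_fract (\<sigma> 2 3 - 2 * \<sigma> 1 2) / to_fract (M1 * M2)) \<and>
         (M1 * M3 \<noteq> 0 \<longrightarrow> to_fract M = to_fract (1 - \<sigma> 2 2) / to_fract (M1 * M3)))"
proof -
  have const: "mcoeff (V $ i) 0 = 0" if "V \<in> {X, Y, Z}" for V i
    using assms(2) that by blast
  have i: "\<forall>V\<in>{X, Y, Z}. let P = matrix (ad V); Q = matrix (exp_end (ad V)) in
      P ** P ** P = G3_g V *m P \<and> Q = mat 1 + G3_A V *m P + G3_B V *m (P ** P)"
    unfolding Let_def using const by (blast intro: matrix_ad_cube matrix_exp_end_ad)
  have Z: "\<And>i. mcoeff (Z $ i) 0 = 0"
    by (rule const) simp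
  define \<sigma> where "\<sigma> = (\<lambda>i j. matrix (exp_end (ad Z)) $ i $ j)"
  define A where "A = G3_A Z"
  define B where "B = G3_B Z"
  define M where "M = B div A ^ 2"
  define M1 where "M1 = - \<sigma> 1 2 - mconst (1/2) * \<sigma> 2 3"
  define M2 where "M2 = \<sigma> 1 1 - \<sigma> 3 3"
  define M3 where "M3 = mconst (1/2) * \<sigma> 2 1 + \<sigma> 3 2"
  have A0: "A \<noteq> 0"
    unfolding A_def by (rule G3_A_neq_0[OF Z])
  have B: "B = M * A ^ 2"
    using G3_g_eq_Lambda(1)[OF Z] by (simp add: M_def A_def B_def)
  \<comment> \<open>In the entries 21 and 23 the factor 2 is kept in front, to cancel against the \<open>1/2\<close> in
      \<open>M\<^sub>1\<close> and \<open>M\<^sub>3\<close>.\<close>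
  have sigma:
    "\<sigma> 1 1 = 1 + A * Z$2 + B * ((Z$2)^2 - 2 * (Z$1 * Z$3))"
    "\<sigma> 1 2 = - (A * Z$1) - B * (Z$1 * Z$2)"
    "\<sigma> 1 3 = 2 * (B * (Z$1)^2)"
    "\<sigma> 2 1 = 2 * (A * Z$3 + B * (Z$2 * Z$3))"
    "\<sigma> 2 2 = 1 - 4 * (B * (Z$1 * Z$3))"
    "\<sigma> 2 3 = 2 * (B * (Z$1 * Z$2) - A * Z$1)"
    "\<sigma> 3 1 = 2 * (B * (Z$3)^2)"
    "\<sigma> 3 2 = A * Z$3 - B * (Z$2 * Z$3)"
    "\<sigma> 3 3 = 1 - A * Z$2 + B * ((Z$2)^2 - 2 * (Z$1 * Z$3))"
    unfolding \<sigma>_def matrix_exp_end_ad[OF Z] matrix_ad_square unfolding matrix_ad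
    by (simp_all add: A_def B_def mat_def matrix_smult_def vector_3 algebra_simps)
  have half: "mconst (1/2) * (2 * x) = x" for x :: "('k, 3 \<times> 'm) mfps"
    unfolding mult_2 by (rule mfps_eqI) (simp only: mcoeff_mconst_mult mcoeff_add, simp)
  have M123: "M1 = 2 * A * Z$1" "M2 = 2 * A * Z$2" "M3 = 2 * A * Z$3"
    by (simp_all only: M1_def M2_def M3_def sigma half) (simp_all add: algebra_simps)
  have two: "(2 :: ('k, 3 \<times> 'm) mfps) \<noteq> 0"
    using half[of 1] by auto
  have ii: "to_fract (Z $ 1) = to_fract M1 / to_fract (2 * A)"
    "to_fract (Z $ 2) = to_fract M2 / to_fract (2 * A)"
    "to_fract (Z $ 3) = to_fract M3 / to_fract (2 * A)"
    "to_fract M = to_fract B / to_fract (A ^ 2)"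
    by (intro to_fract_eq_divideI; simp add: A0 two M123 B)+
  \<comment> \<open>Multiplied out, the quotients are identities that hold even where a denominator vanishes.\<close>
  have quotients:
    "M * (M2^2 - 2 * M1 * M3) = 2 * \<sigma> 1 1 + 2 * \<sigma> 3 3 - 4"
    "M * M1^2 = 2 * \<sigma> 1 3"
    "M * M3^2 = 2 * \<sigma> 3 1"
    "M * (M2 * M3) = \<sigma> 2 1 - 2 * \<sigma> 3 2"
    "M * (M1 * M2) = \<sigma> 2 3 - 2 * \<sigma> 1 2"
    "M * (M1 * M3) = 1 - \<sigma> 2 2"
    by (simp_all add: M123 sigma B power2_eq_square algebra_simps)
  have g: "G3_g Z = fps_subst Lambda ((1 - 2 * M) div M)"
    unfolding M_def A_def B_def by (rule G3_g_eq_Lambda(2)[OF Z])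
  show ?thesis
    unfolding Let_def \<sigma>_def[symmetric] A_def[symmetric] B_def[symmetric] M_def[symmetric]
      M1_def[symmetric] M2_def[symmetric] M3_def[symmetric]
    by (intro conjI impI i[unfolded Let_def] ii g to_fract_eq_divideI quotients)
qed

end
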